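(* Let $G$ be a finite simple graph on the vertex set $V$. Then $\operatorname{ind-match}(G) = \operatorname{min-match}(G)$ if and only if there exist non-negative integers $\alpha, \beta, \gamma$ and a partition of $V$ into pairwise distinct vertices \[ V = \{ v_{i1}, v_{i2} : i = 1, \ldots, \alpha+\beta \} \sqcup \{ z_1, \ldots, z_\alpha \} \sqcup \{ w_1, \ldots, w_\gamma \} \] such that, writing $e_i = \{v_{i1}, v_{i2}\}$ for $i = 1, \ldots, \alpha+\beta$ and $e_i' = \{v_{i1}, z_i\}$ for $i = 1, \ldots, \alpha$, the edge set of $G$ is \[ E(G) = \{ e_i : 1 \le i \le \alpha+\beta \} \cup \{ e_i' : 1 \le i \le \alpha \} \cup E', \] where every edge in $E'$ is of one of the following forms: (i) an edge containing some $z_i$ ($1 \le i \le \alpha$); (ii) an edge consisting of an end vertex of some $e_i$ with $\alpha+1 \le i \le \alpha+\beta$ and some $w_j$ ($1 \le j \le \gamma$); (iii) an edge $\{v_{i1}, w_j\}$ with $1 \le i \le \alpha$ and $1 \le j \le \gamma$.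
   Context: All graphs are finite and simple (no loops, no multiple edges). A matching of $G$ is a set of pairwise disjoint edges; a maximal matching is a matching not properly contained in another matching. $\operatorname{min-match}(G)$ is the minimum cardinality of a maximal matching of $G$. Two edges $e, e'$ are $3$-disjoint if $e \cap e' = \emptyset$ and there is no edge $f$ with $e \cap f \neq \emptyset$ and $e' \cap f \neq \emptyset$; an induced matching is a set of pairwise $3$-disjoint edges, and $\operatorname{ind-match}(G)$ is the maximum cardinality of an induced matching of $G$. *)

theory Defs
  imports Main "HOL-Library.Disjoint_Sets"
begin

text \<open>
  Edges are two-element sets of vertices, which excludes loops and multiple edges.
  The empty graph and isolated vertices are allowed.
\<close>

locale finite_simple_graph =
  fixes V :: "'a set" and E :: "'a set set"
  assumes finite_vertices: "finite V"
    and edges: "\<And>e. e \<in> E \<Longrightarrow> e \<subseteq> V \<and> card e = 2"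

definition matching :: "'a set set \<Rightarrow> 'a set set \<Rightarrow> bool" where
  "matching E M \<longleftrightarrow> M \<subseteq> E \<and> disjoint M"

definition maximal_matching :: "'a set set \<Rightarrow> 'a set set \<Rightarrow> bool" where
  "maximal_matching E M \<longleftrightarrow> matching E M \<and> \<not> (\<exists>M'. matching E M' \<and> M \<subset> M')"

definition three_disjoint :: "'a set set \<Rightarrow> 'a set \<Rightarrow> 'a set \<Rightarrow> bool" where
  "three_disjoint E e e' \<longleftrightarrow>
     e \<inter> e' = {} \<and> \<not> (\<exists>f\<in>E. e \<inter> f \<noteq> {} \<and> e' \<inter> f \<noteq> {})"

definition induced_matching :: "'a set set \<Rightarrow> 'a set set \<Rightarrow> bool" where
  "induced_matching E M \<longleftrightarrow> M \<subseteq> E \<and> pairwise (three_disjoint E) M"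

text \<open>
  For a finite edge set, \<open>Min\<close> and \<open>Max\<close> below range over finite nonempty sets
  (the empty set is an induced matching, and it extends to a maximal matching).
\<close>

definition min_match :: "'a set set \<Rightarrow> nat" where
  "min_match E = Min (card ` {M. maximal_matching E M})"

definition ind_match :: "'a set set \<Rightarrow> nat" where
  "ind_match E = Max (card ` {M. induced_matching E M})"

end

theory Submission
  imports Defs
begin

text \<open>
  If \<open>I\<close> is an induced matching and \<open>N\<close> a maximal one, every edge of \<open>I\<close> meets an edge of \<open>N\<close>
  and every edge of \<open>N\<close> meets at most one edge of \<open>I\<close>. So there is an injection \<open>I \<rightarrow> N\<close>, which is
  a bijection \<open>\<phi>\<close> if the two have the same size. Then \<open>I = {e\<^sub>i}\<close>, and the \<open>z\<^sub>i\<close> are the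
  vertices of \<open>N\<close> that \<open>I\<close> does not cover: they come from those \<open>e\<close> with \<open>\<phi> e \<noteq> e\<close>. The vertices
  \<open>w\<^sub>j\<close> are covered by neither matching.
  Conversely, the \<open>e\<^sub>i\<close> form an induced matching, and the \<open>e'\<^sub>i\<close> together with the \<open>e\<^sub>i\<close> for
  \<open>i > \<alpha>\<close> form a maximal matching of the same size.
\<close>

section \<open>Sizes of induced and maximal matchings\<close>

context finite_simple_graph
begin

lemma finite_edges: "finite E"
  by (rule finite_subset[of _ "Pow V"]) (use edges finite_vertices in auto)

lemma edge_nonempty: "e \<in> E \<Longrightarrow> e \<noteq> {}"
  using edges by fastforce

text \<open>An edge disjoint from all of \<open>N\<close> could be added to \<open>N\<close>; it is
  not already there, because edges are nonempty. Conversely, an extra edge of a larger matching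
  would be disjoint from all of \<open>N\<close>. Later arguments use maximality only in this
  form.\<close>

lemma maximal_matching_iff:
  "maximal_matching E N \<longleftrightarrow> matching E N \<and> (\<forall>e\<in>E. \<exists>f\<in>N. e \<inter> f \<noteq> {})"
proof (intro iffI conjI ballI)
  assume max: "maximal_matching E N"
  then show mN: "matching E N" by (simp add: maximal_matching_def)
  fix e assume e: "e \<in> E"
  show "\<exists>f\<in>N. e \<inter> f \<noteq> {}"
  proof (rule ccontr)
    assume no: "\<not> (\<exists>f\<in>N. e \<inter> f \<noteq> {})"
    have "e \<notin> N" using no edge_nonempty[OF e] by blast
    moreover have "matching E (insert e N)"
      using mN no e by (auto simp: matching_def pairwise_insert disjnt_def)
    ultimately show False using max unfolding maximal_matching_def by blast
  qed
next
  assume N: "matching E N \<and> (\<forall>e\<in>E. \<exists>f\<in>N. e \<inter> f \<noteq> {})"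
  show "maximal_matching E N"
    unfolding maximal_matching_def
  proof (intro conjI notI)
    assume "\<exists>M'. matching E M' \<and> N \<subset> M'"
    then obtain M' e where M': "M' \<subseteq> E" "disjoint M'" "N \<subseteq> M'" "e \<in> M'" "e \<notin> N"
      by (auto simp: matching_def)
    then obtain f where "f \<in> N" "e \<inter> f \<noteq> {}" using N by blast
    with M' show False by (metis disjointD subsetD)
  qed (use N in simp)
qed

text \<open>If \<open>e\<close> and \<open>e'\<close> were distinct, \<open>f\<close> would be a
  connecting edge that \<open>three_disjoint\<close> forbids. Since \<open>f\<close> may be
  \<open>e\<close> itself, this also shows that different edges of \<open>I\<close> share no
  vertex.\<close>

lemma induced_matching_unique:
  assumes "induced_matching E I" "f \<in> E" "e \<in> I" "e' \<in> I" "e \<inter> f \<noteq> {}" "e' \<inter> f \<noteq> {}"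
  shows "e = e'"
  using assms unfolding induced_matching_def three_disjoint_def pairwise_def by blast

lemma obtain_induced_to_maximal:
  assumes "induced_matching E I" "maximal_matching E N"
  obtains \<phi> where "\<phi> ` I \<subseteq> N" "inj_on \<phi> I" "\<And>e. e \<in> I \<Longrightarrow> e \<inter> \<phi> e \<noteq> {}"
proof -
  have N: "N \<subseteq> E" using assms(2) by (simp add: maximal_matching_iff matching_def)
  have "\<forall>e\<in>I. \<exists>f\<in>N. e \<inter> f \<noteq> {}"
    using assms by (auto simp: maximal_matching_iff induced_matching_def)
  then obtain \<phi> where \<phi>: "\<And>e. e \<in> I \<Longrightarrow> \<phi> e \<in> N \<and> e \<inter> \<phi> e \<noteq> {}" by metis
  have "inj_on \<phi> I"
    by (rule inj_onI) (metis \<phi> N assms(1) induced_matching_unique subsetD)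
  with \<phi> show thesis using that by blast
qed

lemma card_induced_le_card_maximal:
  assumes "induced_matching E I" "maximal_matching E N"
  shows "card I \<le> card N"
proof -
  have "finite N"
    using assms(2) finite_edges finite_subset by (auto simp: maximal_matching_def matching_def)
  then show ?thesis
    using obtain_induced_to_maximal[OF assms] card_inj_on_le by metis
qed

lemma finite_induced_matchings: "finite {M. induced_matching E M}"
  by (rule finite_subset[of _ "Pow E"]) (auto simp: induced_matching_def finite_edges)

lemma finite_maximal_matchings: "finite {M. maximal_matching E M}"
  by (rule finite_subset[of _ "Pow E"])
    (auto simp: maximal_matching_def matching_def finite_edges)

text \<open>This makes the set under \<open>Min\<close> in \<open>min_match\<close> nonempty, so
  that the minimum is attained.\<close>

lemma ex_maximal_matching: "\<exists>M. maximal_matching E M"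
proof -
  have "finite {M. matching E M}"
    by (rule finite_subset[of _ "Pow E"]) (auto simp: matching_def finite_edges)
  moreover have "{} \<in> {M. matching E M}" by (simp add: matching_def)
  ultimately obtain M where "M \<in> {M. matching E M}"
    "\<forall>M'\<in>{M. matching E M}. M \<subseteq> M' \<longrightarrow> M = M'"
    using finite_has_maximal[of "{M. matching E M}"] by blast
  then show ?thesis unfolding maximal_matching_def by blast
qed

text \<open>No induced matching is larger than any maximal one. Hence a single pair of equal size
  forces \<open>I\<close> to be largest and \<open>N\<close> to be smallest. The theorem becomes a
  question about one such pair.\<close>

lemma ind_match_eq_min_match_iff:
  "ind_match E = min_match E \<longleftrightarrow>
    (\<exists>I N. induced_matching E I \<and> maximal_matching E N \<and> card I = card N)"
proof
  have "{} \<in> {M. induced_matching E M}" by (simp add: induced_matching_def)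
  then have "ind_match E \<in> card ` {M. induced_matching E M}"
    unfolding ind_match_def by (intro Max_in) (use finite_induced_matchings in auto)
  moreover have "min_match E \<in> card ` {M. maximal_matching E M}"
    unfolding min_match_def
    by (intro Min_in) (use finite_maximal_matchings ex_maximal_matching in auto)
  moreover assume "ind_match E = min_match E"
  ultimately show "\<exists>I N. induced_matching E I \<and> maximal_matching E N \<and> card I = card N"
    by auto metis
next
  assume "\<exists>I N. induced_matching E I \<and> maximal_matching E N \<and> card I = card N"
  then obtain I N where IN: "induced_matching E I" "maximal_matching E N" "card I = card N"
    by blast
  have "ind_match E = card I"
    unfolding ind_match_def
  proof (rule Max_eqI)
    show "card I \<in> card ` {M. induced_matching E M}" using IN(1) by blast
  qed (use finite_induced_matchings card_induced_le_card_maximal[OF _ IN(2)] IN(3) in auto)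
  moreover have "min_match E = card N"
    unfolding min_match_def
  proof (rule Min_eqI)
    show "card N \<in> card ` {M. maximal_matching E M}" using IN(2) by blast
  qed (use finite_maximal_matchings card_induced_le_card_maximal[OF IN(1)] IN(3) in auto)
  ultimately show "ind_match E = min_match E" using IN(3) by simp
qed

end

text \<open>Used to number the edges of \<open>I\<close> so that those with an associated z come
  first, as the index ranges of the partition demand.\<close>

lemma ex_bij_betw_nat_Un:
  assumes "finite A" "finite B" "A \<inter> B = {}"
  shows "\<exists>g. bij_betw g {1..card A + card B} (A \<union> B) \<and> g ` {1..card A} = A
    \<and> g ` {card A + 1..card A + card B} = B"
proof -
  obtain a where a: "bij_betw a {1..card A} A"
    using ex_bij_betw_nat_finite_1[OF assms(1)] by blast
  have "\<exists>b. bij_betw b {card A + 1..card A + card B} B"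
    by (rule finite_same_card_bij) (use assms in auto)
  then obtain b where b: "bij_betw b {card A + 1..card A + card B} B" ..
  define g where "g i = (if i \<le> card A then a i else b i)" for i
  have ga: "bij_betw g {1..card A} A"
    using a by (subst bij_betw_cong[of _ g a]) (auto simp: g_def)
  have gb: "bij_betw g {card A + 1..card A + card B} B"
    using b by (subst bij_betw_cong[of _ g b]) (auto simp: g_def)
  have "{1..card A} \<union> {card A + 1..card A + card B} = {1..card A + card B}" by auto
  with bij_betw_combine[OF ga gb assms(3)] ga gb show ?thesis
    by (auto simp: bij_betw_def)
qed

theorem theorem2p3:
  fixes V :: "'a set" and E :: "'a set set"
  assumes "finite_simple_graph V E"
  shows "ind_match E = min_match E \<longleftrightarrow>
    (\<exists>(\<alpha>::nat) (\<beta>::nat) (\<gamma>::nat) (v :: nat \<Rightarrow> nat \<Rightarrow> 'a) (z :: nat \<Rightarrow> 'a) (w :: nat \<Rightarrow> 'a) (E' :: 'a set set).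
       inj_on (\<lambda>(i, k). v i k) ({1..\<alpha>+\<beta>} \<times> {1, 2}) \<and>
       inj_on z {1..\<alpha>} \<and>
       inj_on w {1..\<gamma>} \<and>
       {v i k | i k. i \<in> {1..\<alpha>+\<beta>} \<and> k \<in> {1, 2}} \<inter> z ` {1..\<alpha>} = {} \<and>
       {v i k | i k. i \<in> {1..\<alpha>+\<beta>} \<and> k \<in> {1, 2}} \<inter> w ` {1..\<gamma>} = {} \<and>
       z ` {1..\<alpha>} \<inter> w ` {1..\<gamma>} = {} \<and>
       V = {v i k | i k. i \<in> {1..\<alpha>+\<beta>} \<and> k \<in> {1, 2}} \<union> z ` {1..\<alpha>} \<union> w ` {1..\<gamma>} \<and>
       E = {{v i 1, v i 2} | i. i \<in> {1..\<alpha>+\<beta>}} \<union> {{v i 1, z i} | i. i \<in> {1..\<alpha>}} \<union> E' \<and>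
       (\<forall>e\<in>E'.
          (\<exists>i\<in>{1..\<alpha>}. z i \<in> e) \<or>
          (\<exists>i\<in>{\<alpha>+1..\<alpha>+\<beta>}. \<exists>u\<in>{v i 1, v i 2}. \<exists>j\<in>{1..\<gamma>}. e = {u, w j}) \<or>
          (\<exists>i\<in>{1..\<alpha>}. \<exists>j\<in>{1..\<gamma>}. e = {v i 1, w j})))"
proof -
  interpret finite_simple_graph V E by (fact assms)
  show ?thesis
    unfolding ind_match_eq_min_match_iff
  proof (intro iffI; elim exE conjE)

    \<comment> \<open>From equal sizes to the partition\<close>
    fix I N assume I: "induced_matching E I" and N: "maximal_matching E N"
      and card_eq: "card I = card N"
    obtain \<phi> where \<phi>: "\<phi> ` I \<subseteq> N" "inj_on \<phi> I" "\<And>e. e \<in> I \<Longrightarrow> e \<inter> \<phi> e \<noteq> {}"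
      by (rule obtain_induced_to_maximal[OF I N]) blast
    have IE: "I \<subseteq> E" using I by (simp add: induced_matching_def)
    have NE: "N \<subseteq> E" and disjN: "disjoint N" and Nmeets: "\<And>e. e \<in> E \<Longrightarrow> \<exists>f\<in>N. e \<inter> f \<noteq> {}"
      using N by (auto simp: maximal_matching_iff matching_def)
    have finI: "finite I" and finN: "finite N"
      using IE NE finite_edges finite_subset by auto
    have N_eq: "N = \<phi> ` I"
      using card_subset_eq[OF finN \<phi>(1)] card_image[OF \<phi>(2)] card_eq by simp
    have \<phi>E: "\<phi> e \<in> E" if "e \<in> I" for e using that NE \<phi>(1) by blast
    \<comment> \<open>The edge \<phi> e already meets \<open>e\<close>, so it can meet no other edge
      of \<open>I\<close>.\<close>
    have \<phi>_only: "e = e'" if "e \<in> I" "e' \<in> I" "x \<in> e'" "x \<in> \<phi> e" for e e' x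
      using induced_matching_unique[OF I \<phi>E[OF that(1)] that(1,2)] \<phi>(3)[OF that(1)] that by blast
    have \<phi>_disj: "e = e'" if "e \<in> I" "e' \<in> I" "x \<in> \<phi> e" "x \<in> \<phi> e'" for e e' x
    proof -
      have "\<phi> e \<in> N" "\<phi> e' \<in> N" using that \<phi>(1) by auto
      then have "\<phi> e = \<phi> e'" using disjointD[OF disjN] that(3,4) by blast
      then show ?thesis using inj_onD[OF \<phi>(2)] that(1,2) by blast
    qed
    have I_disj: "e = e'" if "e \<in> I" "e' \<in> I" "x \<in> e" "x \<in> e'" for e e' x
      using induced_matching_unique[OF I subsetD[OF IE that(1)] that(1,2)] that(3,4) by blast
    \<comment> \<open>Here \<open>c\<close> is a vertex common to \<open>e\<close> and \<phi> e, and
      \<open>u\<close>, \<open>d\<close> are the remaining ends of the two edges. The case \<phi> e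
      = e is included, and then \<open>u\<close> and \<open>d\<close> coincide.\<close>
    have "\<exists>c u d. e = {c, u} \<and> c \<noteq> u \<and> \<phi> e = {c, d} \<and> c \<noteq> d" if e: "e \<in> I" for e
    proof -
      obtain c where c: "c \<in> e" "c \<in> \<phi> e" using \<phi>(3)[OF e] by blast
      have "\<exists>y. p = {c, y} \<and> c \<noteq> y" if "p \<in> E" "c \<in> p" for p
        using edges[OF that(1)] that(2) unfolding card_2_iff by blast
      from this[OF subsetD[OF IE e] c(1)] this[OF \<phi>E[OF e] c(2)] show ?thesis by blast
    qed
    then obtain c u d where cud:
      "\<And>e. e \<in> I \<Longrightarrow> e = {c e, u e}" "\<And>e. e \<in> I \<Longrightarrow> c e \<noteq> u e"
      "\<And>e. e \<in> I \<Longrightarrow> \<phi> e = {c e, d e}" "\<And>e. e \<in> I \<Longrightarrow> c e \<noteq> d e"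
      by metis
    define A where "A = {e \<in> I. \<phi> e \<noteq> e}"
    define B where "B = {e \<in> I. \<phi> e = e}"
    have AB: "A \<union> B = I" "A \<inter> B = {}" "finite A" "finite B"
      using finI by (auto simp: A_def B_def)
    define \<alpha> where "\<alpha> = card A"
    define \<beta> where "\<beta> = card B"
    obtain g where g: "bij_betw g {1..\<alpha> + \<beta>} I" "g ` {1..\<alpha>} = A" "g ` {\<alpha> + 1..\<alpha> + \<beta>} = B"
      using ex_bij_betw_nat_Un[OF AB(3,4,2)] unfolding \<alpha>_def \<beta>_def AB(1) by blast
    have gI: "g i \<in> I" if "i \<in> {1..\<alpha> + \<beta>}" for i using g(1) that by (auto simp: bij_betw_def)
    have g_inj: "i = j" if "g i = g j" "i \<in> {1..\<alpha> + \<beta>}" "j \<in> {1..\<alpha> + \<beta>}" for i j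
      using g(1) that by (auto simp: bij_betw_def dest: inj_onD)
    \<comment> \<open>The shared vertex must be the first one, since it is the end of e_i that lies
      on e'_i. For i > \<alpha> the formula for \<open>z\<close> returns \<open>v i 2\<close>, but
      such indices are outside the range used.\<close>
    define v where "v i k = (if k = 1 then c (g i) else u (g i))" for i and k :: nat
    define z where "z i = d (g i)" for i
    define VS where "VS = {v i k | i k. i \<in> {1..\<alpha>+\<beta>} \<and> k \<in> {1, 2}}"
    have v_simps: "v i 1 = c (g i)" "v i 2 = u (g i)" for i by (simp_all add: v_def)
    have gv: "g i = {v i 1, v i 2}" "v i 1 \<noteq> v i 2" "\<phi> (g i) = {v i 1, z i}" "v i 1 \<noteq> z i"
      if "i \<in> {1..\<alpha> + \<beta>}" for i
      unfolding v_simps z_def by (fact cud[OF gI[OF that]])+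
    have gA: "\<phi> (g i) \<noteq> g i" if "i \<in> {1..\<alpha>}" for i
      using imageI[OF that, of g] unfolding g(2) A_def by simp
    have gB: "\<phi> (g i) = g i" if "i \<in> {\<alpha> + 1..\<alpha> + \<beta>}" for i
      using imageI[OF that, of g] unfolding g(3) B_def by simp
    \<comment> \<open>Since \<open>z i\<close> lies on \<phi> (g i), the only edge of
      \<open>I\<close> that could contain it is \<open>g i\<close>. Then \<open>z i\<close> would be
      \<open>v i 2\<close> and \<phi> would fix \<open>g i\<close>, which is excluded for i \<le>
      \<alpha>.\<close>
    have z_notin: "z i \<notin> e" if "i \<in> {1..\<alpha>}" "e \<in> I" for i e
    proof
      assume "z i \<in> e"
      have i: "i \<in> {1..\<alpha> + \<beta>}" using that by auto
      have "g i = e" using \<phi>_only[OF gI[OF i] that(2) \<open>z i \<in> e\<close>] gv[OF i] by blast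
      then have "z i = v i 2" using \<open>z i \<in> e\<close> gv[OF i] by auto
      then show False using gA[OF that(1)] gv[OF i] by simp
    qed
    have VS: "VS = \<Union>I"
    proof -
      have "\<Union>I = (\<Union>i\<in>{1..\<alpha>+\<beta>}. g i)" using g(1) by (auto simp: bij_betw_def)
      also have "\<dots> = (\<Union>i\<in>{1..\<alpha>+\<beta>}. {v i 1, v i 2})" using gv(1) by simp
      also have "\<dots> = VS" unfolding VS_def by blast
      finally show ?thesis by simp
    qed
    have I_image: "I = {{v i 1, v i 2} | i. i \<in> {1..\<alpha>+\<beta>}}"
    proof -
      have "I = g ` {1..\<alpha>+\<beta>}" using g(1) by (auto simp: bij_betw_def)
      then show ?thesis using gv(1) by (auto simp: image_iff)
    qed
    \<comment> \<open>Taking all leftover vertices makes the disjointness from \<open>W\<close>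
      immediate; covering \<open>V\<close> then only needs the other vertices to lie in
      \<open>V\<close>.\<close>
    define W where "W = V - VS - z ` {1..\<alpha>}"
    define \<gamma> where "\<gamma> = card W"
    have "finite W" using finite_vertices by (simp add: W_def)
    then obtain w where w: "bij_betw w {1..\<gamma>} W"
      using ex_bij_betw_nat_finite_1 unfolding \<gamma>_def by blast
    then have wW: "w ` {1..\<gamma>} = W" and w_inj: "inj_on w {1..\<gamma>}" by (auto simp: bij_betw_def)
    define E' where "E' = E - I - N"
    have v_inj: "inj_on (\<lambda>(i, k). v i k) ({1..\<alpha>+\<beta>} \<times> {1, 2})"
    proof -
      have "i = j \<and> k = l"
        if "i \<in> {1..\<alpha>+\<beta>}" "j \<in> {1..\<alpha>+\<beta>}" "k \<in> {1, 2}" "l \<in> {1, 2}" "v i k = v j l" for i j k l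
      proof -
        have "v i k \<in> g i" "v i k \<in> g j"
          using gv(1)[OF that(1)] gv(1)[OF that(2)] that(3,4) that(5)[symmetric] by auto
        then have "i = j" using I_disj gI that(1,2) g_inj by metis
        then show ?thesis using that gv(2)[OF that(1)] by auto
      qed
      then show ?thesis
        unfolding inj_on_def Ball_def split_paired_All mem_Sigma_iff prod.case prod.inject by blast
    qed
    have z_inj: "inj_on z {1..\<alpha>}"
    proof (rule inj_onI)
      fix i j assume ij: "i \<in> {1..\<alpha>}" "j \<in> {1..\<alpha>}" "z i = z j"
      then have ij': "i \<in> {1..\<alpha>+\<beta>}" "j \<in> {1..\<alpha>+\<beta>}" by auto
      have "g i = g j"
        using \<phi>_disj[of "g i" "g j" "z i"] gI[OF ij'(1)] gI[OF ij'(2)] gv(3)[OF ij'(1)] gv(3)[OF ij'(2)] ij(3)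
        by simp
      then show "i = j" using g_inj ij' by blast
    qed
    have VS_z: "VS \<inter> z ` {1..\<alpha>} = {}" using z_notin by (auto simp: VS)
    have VS_w: "VS \<inter> w ` {1..\<gamma>} = {}" and zw: "z ` {1..\<alpha>} \<inter> w ` {1..\<gamma>} = {}"
      unfolding wW W_def by blast+
    have V_eq: "V = VS \<union> z ` {1..\<alpha>} \<union> w ` {1..\<gamma>}"
    proof -
      have "VS \<subseteq> V" using IE edges by (auto simp: VS)
      moreover have "z i \<in> V" if "i \<in> {1..\<alpha>}" for i
      proof -
        have i: "i \<in> {1..\<alpha>+\<beta>}" using that by auto
        show ?thesis using edges[OF \<phi>E[OF gI[OF i]]] gv(3)[OF i] by auto
      qed
      ultimately show ?thesis unfolding wW W_def by auto
    qed
    have E_eq: "E = {{v i 1, v i 2} | i. i \<in> {1..\<alpha>+\<beta>}} \<union> {{v i 1, z i} | i. i \<in> {1..\<alpha>}} \<union> E'"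
    proof -
      have *: "{{v i 1, z i} | i. i \<in> {1..\<alpha>}} = \<phi> ` A"
        using gv(3) unfolding g(2)[symmetric] by (fastforce simp: image_iff)
      \<comment> \<open>On \<open>B\<close> the map \<phi> is the identity, so \<open>N\<close>
        contributes nothing beyond \<open>I\<close> except the edges e'_i, which are the images of
        \<open>A\<close>.\<close>
      have "N = \<phi> ` A \<union> B" unfolding N_eq by (auto simp: A_def B_def)
      then show ?thesis
        using IE NE unfolding * I_image[symmetric] E'_def B_def by blast
    qed
    have N_cases: "\<exists>i. (i \<in> {1..\<alpha>} \<and> f = {v i 1, z i}) \<or>
        (i \<in> {\<alpha>+1..\<alpha>+\<beta>} \<and> f = {v i 1, v i 2})" if f: "f \<in> N" for f
    proof -
      obtain i where i: "i \<in> {1..\<alpha>+\<beta>}" "f = \<phi> (g i)"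
        using f g(1) unfolding N_eq bij_betw_def by blast
      show ?thesis
      proof (cases "i \<le> \<alpha>")
        case True
        then show ?thesis using i gv(3)[OF i(1)] by (intro exI[of _ i]) simp
      next
        case False
        then have "i \<in> {\<alpha>+1..\<alpha>+\<beta>}" using i(1) by auto
        then show ?thesis using i(2) gB gv(1)[OF i(1)] by (intro exI[of _ i]) metis
      qed
    qed
    have E'_cases: "(\<exists>i\<in>{1..\<alpha>}. z i \<in> e) \<or>
          (\<exists>i\<in>{\<alpha>+1..\<alpha>+\<beta>}. \<exists>u\<in>{v i 1, v i 2}. \<exists>j\<in>{1..\<gamma>}. e = {u, w j}) \<or>
          (\<exists>i\<in>{1..\<alpha>}. \<exists>j\<in>{1..\<gamma>}. e = {v i 1, w j})" if e: "e \<in> E'" for e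
    proof (cases "\<exists>i\<in>{1..\<alpha>}. z i \<in> e")
      case False
      have eE: "e \<in> E" "e \<notin> I" using e by (auto simp: E'_def)
      obtain f where f: "f \<in> N" "e \<inter> f \<noteq> {}" using Nmeets[OF eE(1)] by blast
      obtain i where i: "(i \<in> {1..\<alpha>} \<and> f = {v i 1, z i}) \<or>
        (i \<in> {\<alpha>+1..\<alpha>+\<beta>} \<and> f = {v i 1, v i 2})" using N_cases[OF f(1)] by blast
      \<comment> \<open>With the z's ruled out, an edge of \<open>N\<close> can meet
        \<open>e\<close> only in these vertices. For i \<le> \<alpha> the vertex
        \<open>v i 2\<close> is not on the edge of \<open>N\<close> with index \<open>i\<close>,
        which is why form (iii) allows only \<open>v i 1\<close>.\<close>
      then obtain x where x: "x \<in> e" "(i \<in> {1..\<alpha>} \<and> x = v i 1) \<or>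
        (i \<in> {\<alpha>+1..\<alpha>+\<beta>} \<and> x \<in> {v i 1, v i 2})" using f(2) False by blast
      then have i': "i \<in> {1..\<alpha>+\<beta>}" and xg: "x \<in> g i" using gv(1)[of i] by auto
      have "card e = 2" "e \<subseteq> V" using edges[OF eE(1)] by auto
      then obtain y where y: "e = {x, y}" "x \<noteq> y" using x(1) unfolding card_2_iff by blast
      \<comment> \<open>Otherwise both ends of \<open>e\<close> lie on edges of \<open>I\<close>. By
        uniqueness this is one edge, hence \<open>e\<close> itself, whereas \<open>E'\<close>
        excludes \<open>I\<close>. Being neither in \<open>VS\<close> nor a z, \<open>y\<close> must
        be some w.\<close>
      have "y \<notin> VS"
      proof
        assume "y \<in> VS"
        then obtain e' where e': "e' \<in> I" "y \<in> e'" unfolding VS by blast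
        have "g i = e'"
          using induced_matching_unique[OF I eE(1) gI[OF i'] e'(1)] xg e'(2) y(1) by blast
        then have "y \<in> g i" using e' by simp
        then have "e = g i" using xg y gv(1)[OF i'] by auto
        then show False using eE(2) gI[OF i'] by simp
      qed
      then have "y \<in> w ` {1..\<gamma>}" using V_eq \<open>e \<subseteq> V\<close> y(1) False by auto
      then show ?thesis using x(2) y(1) by blast
    qed blast
    show "(\<exists>(\<alpha>::nat) (\<beta>::nat) (\<gamma>::nat) (v :: nat \<Rightarrow> nat \<Rightarrow> 'a) (z :: nat \<Rightarrow> 'a) (w :: nat \<Rightarrow> 'a) (E' :: 'a set set).
       inj_on (\<lambda>(i, k). v i k) ({1..\<alpha>+\<beta>} \<times> {1, 2}) \<and>
       inj_on z {1..\<alpha>} \<and>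
       inj_on w {1..\<gamma>} \<and>
       {v i k | i k. i \<in> {1..\<alpha>+\<beta>} \<and> k \<in> {1, 2}} \<inter> z ` {1..\<alpha>} = {} \<and>
       {v i k | i k. i \<in> {1..\<alpha>+\<beta>} \<and> k \<in> {1, 2}} \<inter> w ` {1..\<gamma>} = {} \<and>
       z ` {1..\<alpha>} \<inter> w ` {1..\<gamma>} = {} \<and>
       V = {v i k | i k. i \<in> {1..\<alpha>+\<beta>} \<and> k \<in> {1, 2}} \<union> z ` {1..\<alpha>} \<union> w ` {1..\<gamma>} \<and>
       E = {{v i 1, v i 2} | i. i \<in> {1..\<alpha>+\<beta>}} \<union> {{v i 1, z i} | i. i \<in> {1..\<alpha>}} \<union> E' \<and>
       (\<forall>e\<in>E'.
          (\<exists>i\<in>{1..\<alpha>}. z i \<in> e) \<or>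
          (\<exists>i\<in>{\<alpha>+1..\<alpha>+\<beta>}. \<exists>u\<in>{v i 1, v i 2}. \<exists>j\<in>{1..\<gamma>}. e = {u, w j}) \<or>
          (\<exists>i\<in>{1..\<alpha>}. \<exists>j\<in>{1..\<gamma>}. e = {v i 1, w j})))"
      by (intro exI[of _ \<alpha>] exI[of _ \<beta>] exI[of _ \<gamma>] exI[of _ v] exI[of _ z] exI[of _ w] exI[of _ E'])
        (intro conjI ballI v_inj z_inj w_inj VS_z[unfolded VS_def] VS_w[unfolded VS_def] zw
          V_eq[unfolded VS_def] E_eq E'_cases)
  next

    \<comment> \<open>From the partition to two matchings of equal size\<close>
    fix \<alpha> \<beta> \<gamma> :: nat and v :: "nat \<Rightarrow> nat \<Rightarrow> 'a" and z w :: "nat \<Rightarrow> 'a" and E' :: "'a set set"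
    let ?VS = "{v i k | i k. i \<in> {1..\<alpha>+\<beta>} \<and> k \<in> {1, 2}}"
    assume v_inj: "inj_on (\<lambda>(i, k). v i k) ({1..\<alpha>+\<beta>} \<times> {1, 2})"
      and z_inj: "inj_on z {1..\<alpha>}"
      and VS_z: "?VS \<inter> z ` {1..\<alpha>} = {}" and VS_w: "?VS \<inter> w ` {1..\<gamma>} = {}"
      and E_eq: "E = {{v i 1, v i 2} | i. i \<in> {1..\<alpha>+\<beta>}} \<union> {{v i 1, z i} | i. i \<in> {1..\<alpha>}} \<union> E'"
      and E': "\<forall>e\<in>E'.
          (\<exists>i\<in>{1..\<alpha>}. z i \<in> e) \<or>
          (\<exists>i\<in>{\<alpha>+1..\<alpha>+\<beta>}. \<exists>u\<in>{v i 1, v i 2}. \<exists>j\<in>{1..\<gamma>}. e = {u, w j}) \<or>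
          (\<exists>i\<in>{1..\<alpha>}. \<exists>j\<in>{1..\<gamma>}. e = {v i 1, w j})"
    \<comment> \<open>The second end of the i-th edge of the maximal matching. It merges the edges
      e'_i for i \<le> \<alpha> and e_i for i > \<alpha> into the single family
      \<open>f\<close>.\<close>
    define t where "t i = (if i \<le> \<alpha> then z i else v i 2)" for i
    define e where "e i = {v i 1, v i 2}" for i
    define f where "f i = {v i 1, t i}" for i
    have v_eq: "i = j \<and> k = l" if "v i k = v j l" "i \<in> {1..\<alpha>+\<beta>}" "j \<in> {1..\<alpha>+\<beta>}"
      "k \<in> {1, 2}" "l \<in> {1, 2}" for i j k l
      using inj_onD[OF v_inj, of "(i, k)" "(j, l)"] that by auto
    have vz: "v i k \<noteq> z j" if "i \<in> {1..\<alpha>+\<beta>}" "k \<in> {1, 2}" "j \<in> {1..\<alpha>}" for i j k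
      using VS_z that by blast
    have e_disj: "i = j" if "i \<in> {1..\<alpha>+\<beta>}" "j \<in> {1..\<alpha>+\<beta>}" "e i \<inter> e j \<noteq> {}" for i j
    proof -
      have "\<exists>k\<in>{1, 2}. \<exists>l\<in>{1, 2}. v i k = v j l" using that(3) unfolding e_def by auto
      then show ?thesis using v_eq that(1,2) by blast
    qed
    have t_v: "t i \<noteq> v j 1" if "i \<in> {1..\<alpha>+\<beta>}" "j \<in> {1..\<alpha>+\<beta>}" for i j
      using that vz[of j 1 i] v_eq[of i 2 j 1] by (auto simp: t_def)
    have t_inj: "i = j" if "t i = t j" "i \<in> {1..\<alpha>+\<beta>}" "j \<in> {1..\<alpha>+\<beta>}" for i j
      using that vz[of j 2 i] vz[of i 2 j] v_eq[of i 2 j 2] inj_onD[OF z_inj, of i j]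
      by (auto simp: t_def split: if_splits)
    have f_disj: "i = j" if "i \<in> {1..\<alpha>+\<beta>}" "j \<in> {1..\<alpha>+\<beta>}" "f i \<inter> f j \<noteq> {}" for i j
    proof -
      \<comment> \<open>Of the four ways to meet, the two mixed ones are impossible by
        \<open>t_v\<close>, and the other two give i = j by injectivity.\<close>
      have "v i 1 = v j 1 \<or> v i 1 = t j \<or> v j 1 = t i \<or> t i = t j"
        using that(3) unfolding f_def by auto
      then show ?thesis using that(1,2) v_eq[of i 1 j 1] t_v t_inj by (metis insertI1)
    qed
    have "inj_on e {1..\<alpha>+\<beta>}"
      by (rule inj_onI, rule e_disj) (simp_all add: e_def)
    moreover have "inj_on f {1..\<alpha>+\<beta>}"
      by (rule inj_onI, rule f_disj) (simp_all add: f_def)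
    ultimately have "card (e ` {1..\<alpha>+\<beta>}) = card (f ` {1..\<alpha>+\<beta>})"
      by (simp add: card_image)
    moreover have "induced_matching E (e ` {1..\<alpha>+\<beta>})"
      unfolding induced_matching_def
    proof (intro conjI pairwiseI)
      show "e ` {1..\<alpha>+\<beta>} \<subseteq> E" unfolding E_eq e_def by blast
      fix p q assume "p \<in> e ` {1..\<alpha>+\<beta>}" "q \<in> e ` {1..\<alpha>+\<beta>}" "p \<noteq> q"
      then obtain i j where ij: "i \<in> {1..\<alpha>+\<beta>}" "j \<in> {1..\<alpha>+\<beta>}" "i \<noteq> j"
        and pq: "p = e i" "q = e j" by blast
      have disj: "e i \<inter> e j = {}" using e_disj ij by blast
      \<comment> \<open>A connecting edge has one end on \<open>e i\<close> and one on
        \<open>e j\<close>, so all its vertices are v's. Every edge of \<open>E'\<close> and every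
        e'_i contains a z or a w. So \<open>h\<close> would be some \<open>e l\<close> meeting both,
        which forces i = l = j.\<close>
      have False if h: "h \<in> E" "e i \<inter> h \<noteq> {}" "e j \<inter> h \<noteq> {}" for h
      proof -
        obtain a b where ab: "a \<in> e i" "b \<in> e j" "a \<in> h" "b \<in> h" using h by blast
        then have "a \<noteq> b" using disj by blast
        then have h_eq: "h = {a, b}" using edges[OF h(1)] ab unfolding card_2_iff by blast
        then have "h \<subseteq> ?VS" using ab ij by (auto simp: e_def)
        then have no_zw: "\<And>l. l \<in> {1..\<alpha>} \<Longrightarrow> z l \<notin> h" "\<And>l. l \<in> {1..\<gamma>} \<Longrightarrow> w l \<notin> h"
          using VS_z VS_w by blast+
        then have "h \<notin> E'" using E' by blast
        moreover have "h \<notin> {{v i 1, z i} | i. i \<in> {1..\<alpha>}}" using no_zw by blast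
        ultimately obtain l where "l \<in> {1..\<alpha>+\<beta>}" "h = e l"
          using h(1) unfolding E_eq e_def by blast
        then show False using h(2,3) e_disj ij by metis
      qed
      then show "three_disjoint E p q" using disj unfolding three_disjoint_def pq by blast
    qed
    moreover have "maximal_matching E (f ` {1..\<alpha>+\<beta>})"
      unfolding maximal_matching_iff matching_def
    proof (intro conjI ballI)
      have "f i \<in> E" if i: "i \<in> {1..\<alpha>+\<beta>}" for i
      proof (cases "i \<le> \<alpha>")
        case True
        then have "f i = {v i 1, z i}" "i \<in> {1..\<alpha>}" using i by (auto simp: f_def t_def)
        then show ?thesis unfolding E_eq by blast
      next
        case False
        then have "f i = {v i 1, v i 2}" by (simp add: f_def t_def)
        then show ?thesis using i unfolding E_eq by blast
      qed
      then show "f ` {1..\<alpha>+\<beta>} \<subseteq> E" by blast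
      show "disjoint (f ` {1..\<alpha>+\<beta>})" using f_disj by (intro disjointI) blast
      fix h assume "h \<in> E"
      then consider i where "i \<in> {1..\<alpha>+\<beta>}" "h = {v i 1, v i 2}"
        | i where "i \<in> {1..\<alpha>}" "h = {v i 1, z i}" | "h \<in> E'"
        unfolding E_eq by blast
      \<comment> \<open>Every edge has a vertex covered by the family \<open>f\<close>: in form (i)
        it is z_i = \<open>t i\<close>; in form (ii) both ends of e_i are covered because i >
        \<alpha>; in form (iii) it is \<open>v i 1\<close>.\<close>
      then have "\<exists>i\<in>{1..\<alpha>+\<beta>}. v i 1 \<in> h \<or> t i \<in> h"
      proof cases
        case (1 i)
        then show ?thesis by (intro bexI[of _ i]) simp_all
      next
        case (2 i)
        then show ?thesis by (intro bexI[of _ i]) simp_all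
      next
        case 3
        from bspec[OF E' 3] show ?thesis
        proof (elim disjE bexE)
          fix i assume "i \<in> {1..\<alpha>}" "z i \<in> h"
          then show ?thesis by (intro bexI[of _ i]) (simp_all add: t_def)
        next
          fix i u j assume "i \<in> {\<alpha>+1..\<alpha>+\<beta>}" "u \<in> {v i 1, v i 2}" "h = {u, w j}"
          then show ?thesis by (intro bexI[of _ i]) (auto simp: t_def)
        next
          fix i j assume "i \<in> {1..\<alpha>}" "h = {v i 1, w j}"
          then show ?thesis by (intro bexI[of _ i]) simp_all
        qed
      qed
      then obtain i where "i \<in> {1..\<alpha>+\<beta>}" "h \<inter> f i \<noteq> {}" unfolding f_def by blast
      then show "\<exists>p\<in>f ` {1..\<alpha>+\<beta>}. h \<inter> p \<noteq> {}" by blast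
    qed
    ultimately show "\<exists>I N. induced_matching E I \<and> maximal_matching E N \<and> card I = card N"
      by blast
  qed
qed

end
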